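(* Let $n\ge 1$, let $q$ be an indeterminate and put $t=q^{-1}$. Let $T=(C_0,\dots,C_r)$ be a semistandard Young tableau of type $A_n$ with shape $\lambda$ and content $\mu$, where $C_0,\dots,C_r$ are its columns from left to right. Then for every $i\in\{0,\dots,r-1\}$ $$c(C_i,C_{i+1}) \;=\; t^{-\langle \lambda_{(i)}+\mu_{(i)},\rho\rangle}\,\frac{\varphi_{C_i}(t)}{\varphi_{|C_i|-|C_{i+1}|}(t)},$$ and $$c(C_r)\;=\;t^{-\langle \lambda_{(r)}+\mu_{(r)},\rho\rangle}\,\frac{\varphi_{C_r}(t)}{\varphi_{|C_r|}(t)}.$$ Here $c(C_i,C_{i+1})$ is computed with any admissible choices of reflections in the tree construction described in the context.
   Context: Tableaux. The alphabet is $\{1<2<\dots<n+1\}$, and $\epsilon_1,\dots,\epsilon_{n+1}$ denote the standard basis vectors of $\mathbb{Z}^{n+1}$. A Young tableau of type $A_n$ of shape $\lambda$ is the left-aligned diagram of a partition $\lambda=(\lambda_1\ge\lambda_2\ge\dots\ge\lambda_k>0)$ with $k\le n$ rows (row $j$ has $\lambda_j$ boxes), each box filled with a letter so that entries strictly increase from top to bottom in every column. It is semistandard if entries weakly increase from left to right in every row. Its content is $\mu=\sum_a \mu_a\epsilon_a$, where $\mu_a$ is the number of boxes with entry $a$. A column $C$ is identified with the set of its entries; $|C|$ is its number of boxes. For a column $C$ with $m$ boxes put $\lambda_C=\epsilon_1+\dots+\epsilon_m$ and $\mu_C=\sum_{a\in C}\epsilon_a$, and write $\lambda_{(i)}=\lambda_{C_i}$,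 $\mu_{(i)}=\mu_{C_i}$. Let $\rho=\sum_{k=1}^{n+1}\frac{n+2-2k}{2}\epsilon_k$, and let $\langle\cdot,\cdot\rangle$ be the standard inner product on $\mathbb{R}^{n+1}$. Reflections on columns. For $1\le j\le n$, the simple reflection $s_j$ acts on a column by interchanging the letters $j$ and $j+1$ (then re-sorting increasingly). We say $s_j$ increases $C$ if $j\in C$ and $j+1\notin C$, decreases $C$ if $j+1\in C$ and $j\notin C$, and fixes $C$ otherwise. Single-column contribution. For a column $C$, $c(C)=q^k$, where $k$ is the length of a sequence $s_{i_1},\dots,s_{i_k}$ such that each $s_{i_l}$ increases $s_{i_{l-1}}\cdots s_{i_1}(C)$ and no simple reflection increases $s_{i_k}\cdots s_{i_1}(C)$. Equivalently, $k=\#\{(a,b): a\in C,\ b\in\{1,\dots,n+1\}\setminus C,\ a<b\}$. Two-column contribution. A pair of columns $(D_1,D_2)$ is a semistandard 2-column tableau if $|D_1|\ge|D_2|$ and, for each $l\le |D_2|$, the $l$-th entry of $D_1$ is $\le$ the $l$-th entry of $D_2$. For such a pair $(C_1,C_2)$ build a rooted tree with root $(C_1,C_2)$ as follows. At a vertex $(D_1,D_2)$, if no $s_j$ increases $D_1$, the vertex is final. Otherwise choose $j$ with $s_j$ increasing $D_1$; the same $j$ is used for all vertices with the same first column. - If $(s_jD_1,s_jD_2)$ is semistandard, it becomes a child of $(D_1,D_2)$. The edge is labelled $s_j^+$ if $s_j$ increases or fixes $D_2$, and $s_j^-$ if $s_j$ decreases $D_2$. In the $s_j^-$ case, $(s_jD_1,D_2)$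 is also a child, with edge label $\mathrm{id}_j^+$. - If $(s_jD_1,s_jD_2)$ is not semistandard, then $(s_jD_1,D_2)$ is the child, with edge label $\mathrm{id}_j^+$. Then $c(C_1,C_2)=\sum_{\sigma}q^{\mathrm{pr}(\sigma)}(q-1)^{\mathrm{pf}(\sigma)}$. The sum runs over all paths $\sigma$ from the root to a final vertex; $\mathrm{pr}(\sigma)$ is the number of edges of $\sigma$ labelled $s_j^+$ for some $j$, and $\mathrm{pf}(\sigma)$ is the number labelled $\mathrm{id}_j^+$. Macdonald-side factors. For $k\ge 0$ let $\varphi_k(t)=(1-t)(1-t^2)\cdots(1-t^k)$, with $\varphi_0=1$. The augmented tableau $\hat T$ is obtained from $T$ by appending at the right end of each row one extra box filled with $\infty$, where $a<\infty$ for all letters $a$. For a box $u$ of $T$ in column $C_i$ and row $j$, with entry $c(u)$, its head $h(u)$ is the set of boxes $v$ of $\hat T$ lying in the column immediately to the right of $C_i$, in some row $\le j$, with $c(u)\le c(v)$. Define $$\varphi_{C_i}(t)=\prod_{u}\bigl(1-t^{|h(u)|}\bigr),$$ where the product runs over the boxes $u$ of $C_i$ such that no $v\in h(u)$ has $c(v)=c(u)$. *)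

theory Defs
  imports
    "HOL-Library.Extended_Nat"
    "HOL-Combinatorics.Transposition"
    "HOL-Computational_Algebra.Polynomial"
    "HOL-Computational_Algebra.Fraction_Field"
begin

text \<open>
  A filling sends a position (row, column) to a letter; only its values on the boxes of the
  diagram matter. Rows and columns are both counted from 0, the letters from 1. A column is the
  set of its entries.
\<close>

type_synonym filling = "nat \<Rightarrow> nat \<Rightarrow> nat"
type_synonym column = "nat set"

definition is_partition :: "nat list \<Rightarrow> bool" where
  "is_partition lam \<longleftrightarrow> sorted_wrt (\<ge>) lam \<and> (\<forall>p\<in>set lam. 0 < p)"

definition boxes :: "nat list \<Rightarrow> (nat \<times> nat) set" where
  "boxes lam = {(j, i). j < length lam \<and> i < lam ! j}"

definition young_tableau :: "nat \<Rightarrow> nat list \<Rightarrow> filling \<Rightarrow> bool" where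
  "young_tableau n lam T \<longleftrightarrow>
     is_partition lam \<and> length lam \<le> n \<and>
     (\<forall>(j, i)\<in>boxes lam. T j i \<in> {1..n + 1}) \<and>
     (\<forall>j j' i. (j, i) \<in> boxes lam \<longrightarrow> (j', i) \<in> boxes lam \<longrightarrow> j < j' \<longrightarrow> T j i < T j' i)"

definition semistandard_tableau :: "nat \<Rightarrow> nat list \<Rightarrow> filling \<Rightarrow> bool" where
  "semistandard_tableau n lam T \<longleftrightarrow>
     young_tableau n lam T \<and>
     (\<forall>j i i'. (j, i) \<in> boxes lam \<longrightarrow> (j, i') \<in> boxes lam \<longrightarrow> i < i' \<longrightarrow> T j i \<le> T j i')"

definition tab_content :: "nat list \<Rightarrow> filling \<Rightarrow> nat \<Rightarrow> nat" where
  "tab_content lam T a = card {(j, i). (j, i) \<in> boxes lam \<and> T j i = a}"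

definition num_columns :: "nat list \<Rightarrow> nat" where
  "num_columns lam = (case lam of [] \<Rightarrow> 0 | p # _ \<Rightarrow> p)"

definition tab_column :: "nat list \<Rightarrow> filling \<Rightarrow> nat \<Rightarrow> column" where
  "tab_column lam T i = {T j i | j. (j, i) \<in> boxes lam}"

text \<open>Vectors of \<open>\<real>\<^sup>n\<^sup>+\<^sup>1\<close> are functions, of which only the values at \<open>1, \<dots>, n + 1\<close> are used.\<close>

definition basis_vec :: "nat \<Rightarrow> nat \<Rightarrow> real" where
  "basis_vec a = (\<lambda>k. if k = a then 1 else 0)"

definition inner_prod :: "nat \<Rightarrow> (nat \<Rightarrow> real) \<Rightarrow> (nat \<Rightarrow> real) \<Rightarrow> real" where
  "inner_prod n x y = (\<Sum>k = 1..n + 1. x k * y k)"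

definition rho :: "nat \<Rightarrow> nat \<Rightarrow> real" where
  "rho n = (\<lambda>k. \<Sum>l = 1..n + 1. (real n + 2 - 2 * real l) / 2 * basis_vec l k)"

definition col_shape :: "column \<Rightarrow> nat \<Rightarrow> real" where
  "col_shape C = (\<lambda>k. \<Sum>a = 1..card C. basis_vec a k)"

definition col_content :: "column \<Rightarrow> nat \<Rightarrow> real" where
  "col_content C = (\<lambda>k. \<Sum>a\<in>C. basis_vec a k)"

definition col_pairing :: "nat \<Rightarrow> column \<Rightarrow> real" where
  "col_pairing n C = inner_prod n (\<lambda>k. col_shape C k + col_content C k) (rho n)"

definition reflect :: "nat \<Rightarrow> column \<Rightarrow> column" where
  "reflect j C = transpose j (j + 1) ` C"

definition increases :: "nat \<Rightarrow> column \<Rightarrow> bool" where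
  "increases j C \<longleftrightarrow> j \<in> C \<and> j + 1 \<notin> C"

definition decreases :: "nat \<Rightarrow> column \<Rightarrow> bool" where
  "decreases j C \<longleftrightarrow> j + 1 \<in> C \<and> j \<notin> C"

definition final_column :: "nat \<Rightarrow> column \<Rightarrow> bool" where
  "final_column n C \<longleftrightarrow> \<not> (\<exists>j\<in>{1..n}. increases j C)"

type_synonym ratfun = "rat poly fract"

definition q :: ratfun where
  "q = Fract [:0, 1:] 1"

definition t :: ratfun where
  "t = inverse q"

fun maximal_increasing_seq :: "nat \<Rightarrow> column \<Rightarrow> nat list \<Rightarrow> bool" where
  "maximal_increasing_seq n C [] \<longleftrightarrow> final_column n C"
| "maximal_increasing_seq n C (j # js) \<longleftrightarrow>
     j \<in> {1..n} \<and> increases j C \<and> maximal_increasing_seq n (reflect j C) js"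

definition contrib1 :: "nat \<Rightarrow> column \<Rightarrow> ratfun" where
  "contrib1 n C = q ^ (THE k. \<exists>js. maximal_increasing_seq n C js \<and> length js = k)"

definition semistandard_pair :: "column \<Rightarrow> column \<Rightarrow> bool" where
  "semistandard_pair D1 D2 \<longleftrightarrow>
     card D1 \<ge> card D2 \<and>
     (\<forall>l < card D2. sorted_list_of_set D1 ! l \<le> sorted_list_of_set D2 ! l)"

text \<open>
  The same reflection is used at all vertices with the same first column, so the choices made in
  building a tree amount to a function of the first column.
\<close>

definition admissible_choice :: "nat \<Rightarrow> (column \<Rightarrow> nat) \<Rightarrow> bool" where
  "admissible_choice n ch \<longleftrightarrow>
     (\<forall>D. D \<subseteq> {1..n + 1} \<longrightarrow> \<not> final_column n D \<longrightarrow> ch D \<in> {1..n} \<and> increases (ch D) D)"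

datatype edge_label = S_plus nat | S_minus nat | Id_plus nat

type_synonym vertex = "column \<times> column"

inductive tree_edge :: "nat \<Rightarrow> (column \<Rightarrow> nat) \<Rightarrow> vertex \<Rightarrow> edge_label \<Rightarrow> vertex \<Rightarrow> bool"
  for n :: nat and ch :: "column \<Rightarrow> nat" where
  plus: "tree_edge n ch (D1, D2) (S_plus j) (reflect j D1, reflect j D2)"
    if "\<not> final_column n D1" "j = ch D1"
       "semistandard_pair (reflect j D1) (reflect j D2)" "\<not> decreases j D2"
| minus: "tree_edge n ch (D1, D2) (S_minus j) (reflect j D1, reflect j D2)"
    if "\<not> final_column n D1" "j = ch D1"
       "semistandard_pair (reflect j D1) (reflect j D2)" "decreases j D2"
| id_minus: "tree_edge n ch (D1, D2) (Id_plus j) (reflect j D1, D2)"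
    if "\<not> final_column n D1" "j = ch D1"
       "semistandard_pair (reflect j D1) (reflect j D2)" "decreases j D2"
| id_fail: "tree_edge n ch (D1, D2) (Id_plus j) (reflect j D1, D2)"
    if "\<not> final_column n D1" "j = ch D1"
       "\<not> semistandard_pair (reflect j D1) (reflect j D2)"

text \<open>
  A path is the list of its edges, each given by its label and its lower end; vertices of the tree
  carrying the same pair of columns are thereby kept apart.
\<close>

inductive tree_path ::
    "nat \<Rightarrow> (column \<Rightarrow> nat) \<Rightarrow> vertex \<Rightarrow> (edge_label \<times> vertex) list \<Rightarrow> bool"
  for n :: nat and ch :: "column \<Rightarrow> nat" where
  stop: "tree_path n ch (D1, D2) []" if "final_column n D1"
| step: "tree_path n ch v ((e, w) # es)" if "tree_edge n ch v e w" "tree_path n ch w es"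

definition pr :: "(edge_label \<times> vertex) list \<Rightarrow> nat" where
  "pr es = length (filter (\<lambda>(e, _). \<exists>j. e = S_plus j) es)"

definition pf :: "(edge_label \<times> vertex) list \<Rightarrow> nat" where
  "pf es = length (filter (\<lambda>(e, _). \<exists>j. e = Id_plus j) es)"

definition contrib2 :: "nat \<Rightarrow> (column \<Rightarrow> nat) \<Rightarrow> column \<Rightarrow> column \<Rightarrow> ratfun" where
  "contrib2 n ch C1 C2 = (\<Sum>es | tree_path n ch (C1, C2) es. q ^ pr es * (q - 1) ^ pf es)"

definition phi :: "nat \<Rightarrow> ratfun \<Rightarrow> ratfun" where
  "phi k x = (\<Prod>l = 1..k. 1 - x ^ l)"

definition aug_boxes :: "nat list \<Rightarrow> (nat \<times> nat) set" where
  "aug_boxes lam = {(j, i). j < length lam \<and> i < lam ! j + 1}"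

definition aug_entry :: "nat list \<Rightarrow> filling \<Rightarrow> nat \<times> nat \<Rightarrow> enat" where
  "aug_entry lam T = (\<lambda>(j, i). if i < lam ! j then enat (T j i) else \<infinity>)"

definition head :: "nat list \<Rightarrow> filling \<Rightarrow> nat \<times> nat \<Rightarrow> (nat \<times> nat) set" where
  "head lam T u =
     {v \<in> aug_boxes lam. snd v = snd u + 1 \<and> fst v \<le> fst u \<and>
        aug_entry lam T u \<le> aug_entry lam T v}"

definition phi_col :: "nat list \<Rightarrow> filling \<Rightarrow> nat \<Rightarrow> ratfun \<Rightarrow> ratfun" where
  "phi_col lam T i x =
     (\<Prod>u | u \<in> boxes lam \<and> snd u = i \<and>
            (\<forall>v\<in>head lam T u. aug_entry lam T v \<noteq> aug_entry lam T u).
        1 - x ^ card (head lam T u))"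

definition col_inv :: "nat \<Rightarrow> column \<Rightarrow> (nat \<times> nat) set" where
  "col_inv n C = {(a, b). a \<in> C \<and> b \<in> {1..n + 1} - C \<and> a < b}"

lemma reflect_subset:
  assumes "C \<subseteq> {1..n + 1}" "j \<in> {1..n}"
  shows "reflect j C \<subseteq> {1..n + 1}"
  using assms by (auto simp: reflect_def transpose_def)

lemma reflect_increases:
  assumes "increases j C"
  shows "reflect j C = insert (j + 1) (C - {j})"
  using assms by (fastforce simp: reflect_def increases_def transpose_def image_iff)

lemma finite_col_inv: "C \<subseteq> {1..n + 1} \<Longrightarrow> finite (col_inv n C)"
  by (rule finite_subset[of _ "{1..n + 1} \<times> {1..n + 1}"]) (auto simp: col_inv_def)

lemma col_inv_reflect:
  assumes "C \<subseteq> {1..n + 1}" "j \<in> {1..n}" "increases j C"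
  shows "card (col_inv n C) = Suc (card (col_inv n (reflect j C)))"
proof -
  let ?s = "transpose j (j + 1)"
  let ?f = "map_prod ?s ?s"
  have r: "reflect j C = insert (j + 1) (C - {j})" by (rule reflect_increases[OF assms(3)])
  have jC: "j \<in> C" "j + 1 \<notin> C" using assms(3) by (auto simp: increases_def)
  have 1: "col_inv n C = insert (j, j + 1) (?f ` col_inv n (reflect j C))" (is "?L = ?R")
  proof (rule set_eqI, clarify)
    fix a b
    have "(a, b) \<in> ?f ` col_inv n (reflect j C) \<longleftrightarrow> (?s a, ?s b) \<in> col_inv n (reflect j C)"
    proof
      assume "(?s a, ?s b) \<in> col_inv n (reflect j C)"
      moreover have "(a, b) = ?f (?s a, ?s b)" by simp
      ultimately show "(a, b) \<in> ?f ` col_inv n (reflect j C)" by (rule rev_image_eqI)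
    qed auto
    moreover have "(a, b) \<in> col_inv n C \<longleftrightarrow>
        (a, b) = (j, j + 1) \<or> (?s a, ?s b) \<in> col_inv n (reflect j C)"
      using jC assms(1,2) unfolding r col_inv_def
      by (cases "a = j"; cases "a = j + 1"; cases "b = j"; cases "b = j + 1") auto
    ultimately show "(a, b) \<in> ?L \<longleftrightarrow> (a, b) \<in> ?R" by blast
  qed
  have 2: "(j, j + 1) \<notin> ?f ` col_inv n (reflect j C)"
    by (auto simp: col_inv_def transpose_def split: if_splits)
  have 3: "inj_on ?f (col_inv n (reflect j C))"
    by (intro inj_on_subset[OF prod.inj_map] inj_transpose) auto
  have "finite (col_inv n (reflect j C))"
    using finite_col_inv reflect_subset[OF assms(1,2)] by blast
  then show ?thesis unfolding 1 using 2 3 by (simp add: card_image)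
qed

lemma final_column_iff:
  assumes "C \<subseteq> {1..n + 1}"
  shows "final_column n C \<longleftrightarrow> col_inv n C = {}"
proof
  assume f: "final_column n C"
  have "b \<in> C" if "a \<in> C" "a \<le> b" "b \<le> n + 1" for a b
    using that(2,3)
  proof (induction b rule: dec_induct)
    case base then show ?case using that by simp
  next
    case (step k)
    moreover have "k \<in> {1..n}" using step that assms by auto
    ultimately show ?case using f by (auto simp: final_column_def increases_def)
  qed
  then show "col_inv n C = {}" by (fastforce simp: col_inv_def)
next
  assume "col_inv n C = {}"
  then show "final_column n C"
    by (force simp: col_inv_def final_column_def increases_def)
qed

lemma maximal_increasing_seq_length:
  assumes "C \<subseteq> {1..n + 1}" "maximal_increasing_seq n C js"
  shows "length js = card (col_inv n C)"
  using assms
proof (induction js arbitrary: C)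
  case Nil
  then show ?case by (simp add: final_column_iff)
next
  case (Cons j js)
  then show ?case using col_inv_reflect[of C n j] reflect_subset[of C n j] by auto
qed

lemma maximal_increasing_seq_exists:
  assumes "C \<subseteq> {1..n + 1}"
  shows "\<exists>js. maximal_increasing_seq n C js"
  using assms
proof (induction "card (col_inv n C)" arbitrary: C rule: less_induct)
  case less
  show ?case
  proof (cases "final_column n C")
    case True
    then have "maximal_increasing_seq n C []" by simp
    then show ?thesis ..
  next
    case False
    then obtain j where j: "j \<in> {1..n}" "increases j C" by (auto simp: final_column_def)
    then obtain js where "maximal_increasing_seq n (reflect j C) js"
      using less.hyps[of "reflect j C"] col_inv_reflect[OF less.prems j] reflect_subset[OF less.prems j(1)]
      by auto
    then have "maximal_increasing_seq n C (j # js)" using j by simp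
    then show ?thesis ..
  qed
qed

lemma contrib1_eq:
  assumes "C \<subseteq> {1..n + 1}"
  shows "contrib1 n C = q ^ card (col_inv n C)"
proof -
  have "(THE k. \<exists>js. maximal_increasing_seq n C js \<and> length js = k) = card (col_inv n C)"
    using maximal_increasing_seq_exists[OF assms] maximal_increasing_seq_length[OF assms]
    by (intro the_equality) auto
  then show ?thesis by (simp add: contrib1_def)
qed

lemma finite_tree_paths:
  assumes "admissible_choice n ch" "D1 \<subseteq> {1..n + 1}"
  shows "finite {es. tree_path n ch (D1, D2) es}"
  using assms(2)
proof (induction "card (col_inv n D1)" arbitrary: D1 D2 rule: less_induct)
  case less
  show ?case
  proof (cases "final_column n D1")
    case True
    have "es = []" if "tree_path n ch (D1, D2) es" for es
      using that
    proof cases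
      case (step e w es')
      from step(2) True show ?thesis by cases auto
    qed
    then have "{es. tree_path n ch (D1, D2) es} \<subseteq> {[]}" by blast
    then show ?thesis by (rule finite_subset) simp
  next
    case False
    let ?j = "ch D1"
    let ?A = "reflect ?j D1"
    let ?B = "reflect ?j D2"
    let ?E = "{(S_plus ?j, (?A, ?B)), (S_minus ?j, (?A, ?B)), (Id_plus ?j, (?A, D2))}"
    let ?P = "\<lambda>w. {es. tree_path n ch w es}"
    have j: "?j \<in> {1..n}" "increases ?j D1"
      using assms(1) less.prems False by (auto simp: admissible_choice_def)
    have fin: "finite (?P (?A, X))" for X
      using less.hyps[of ?A X] col_inv_reflect[OF less.prems j] reflect_subset[OF less.prems j(1)]
      by simp
    have "{es. tree_path n ch (D1, D2) es} \<subseteq> (\<Union>e\<in>?E. (#) e ` ?P (snd e))"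
    proof
      fix es assume "es \<in> {es. tree_path n ch (D1, D2) es}"
      then have "tree_path n ch (D1, D2) es" by simp
      then show "es \<in> (\<Union>e\<in>?E. (#) e ` ?P (snd e))"
      proof cases
        case stop
        then show ?thesis using False by simp
      next
        case (step e w es')
        from step(2) have "(e, w) \<in> ?E" by cases auto
        with step show ?thesis by force
      qed
    qed
    moreover have "finite (\<Union>e\<in>?E. (#) e ` ?P (snd e))"
      using fin by auto
    ultimately show ?thesis by (rule finite_subset)
  qed
qed

lemma inner_prod_basis_sum:
  assumes "S \<subseteq> {1..n + 1}"
  shows "inner_prod n (\<lambda>k. \<Sum>a\<in>S. basis_vec a k) (rho n) = (\<Sum>a\<in>S. (real n + 2 - 2 * real a) / 2)"
proof -
  have fS: "finite S" using assms finite_subset by blast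
  have rho: "rho n k = (real n + 2 - 2 * real k) / 2" if "k \<in> {1..n + 1}" for k
    using that by (simp add: rho_def basis_vec_def if_distrib cong: if_cong)
  have "inner_prod n (\<lambda>k. \<Sum>a\<in>S. basis_vec a k) (rho n) =
      (\<Sum>k = 1..n + 1. if k \<in> S then (real n + 2 - 2 * real k) / 2 else 0)"
    unfolding inner_prod_def
    by (rule sum.cong) (auto simp: rho basis_vec_def fS)
  also have "\<dots> = (\<Sum>a\<in>S. (real n + 2 - 2 * real a) / 2)"
    using assms by (simp add: sum.If_cases Int_absorb1 del: sum.cl_ivl_Suc)
  finally show ?thesis .
qed

lemma col_pairing_integer:
  assumes "C \<subseteq> {1..n + 1}"
  shows "col_pairing n C \<in> \<int>"
proof -
  have m: "card C \<le> n + 1" using card_mono[OF _ assms] by simp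
  have "col_pairing n C =
      inner_prod n (\<lambda>k. \<Sum>a\<in>{1..card C}. basis_vec a k) (rho n) +
      inner_prod n (\<lambda>k. \<Sum>a\<in>C. basis_vec a k) (rho n)"
    by (simp add: col_pairing_def col_shape_def col_content_def inner_prod_def
        distrib_right sum.distrib)
  also have "\<dots> = (\<Sum>a = 1..card C. (real n + 2 - 2 * real a) / 2) +
      (\<Sum>a\<in>C. (real n + 2 - 2 * real a) / 2)"
    using m assms by (subst (1 2) inner_prod_basis_sum) auto
  also have "\<dots> = real (card C) * (real n + 2) - (\<Sum>a = 1..card C. real a) - (\<Sum>a\<in>C. real a)"
  proof -
    have "(\<Sum>a\<in>S. (real n + 2 - 2 * real a) / 2) =
        real (card S) * ((real n + 2) / 2) - (\<Sum>a\<in>S. real a)" for S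
      by (simp add: diff_divide_distrib sum_subtractf)
    note this[of "{1..card C}"] this[of C]
    then show ?thesis by (simp add: field_simps)
  qed
  also have "\<dots> \<in> \<int>" by (intro Ints_diff Ints_mult Ints_add Ints_sum) auto
  finally show ?thesis .
qed

end

theory Submission imports Defs begin

text \<open>
  For columns \<open>D\<^sub>1, D\<^sub>2\<close> put \<open>d(k) = #{a \<in> D\<^sub>1. a \<le> k} - #{a \<in> D\<^sub>2. a \<le> k}\<close>; the pair is
  semistandard iff \<open>d \<ge> 0\<close> everywhere. The head of a box with entry \<open>u \<notin> D\<^sub>2\<close> has \<open>d(u)\<close> boxes, and
  the pairing with \<open>\<rho>\<close> counts the inversions \<open>\<ell>(D\<^sub>1)\<close> of the first column, so the claim is that
  the tree computes \<open>q\<^sup>\<ell> \<Prod>\<^sub>u (1 - t\<^sup>d\<^sup>(\<^sup>u\<^sup>)) / \<phi>(t)\<close>, the product over \<open>u \<in> D\<^sub>1 - D\<^sub>2\<close>. When \<open>s\<^sub>j\<close>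
  increases \<open>D\<^sub>1\<close> and does not decrease \<open>D\<^sub>2\<close>, the product is unchanged and \<open>\<ell>\<close> drops by one. When it
  decreases \<open>D\<^sub>2\<close>, put \<open>x = d(j - 1)\<close>; the recursion is \<open>q (1 - t\<^sup>x\<^sup>+\<^sup>1) = (1 - t\<^sup>x) + (q - 1)\<close>, where
  \<open>x = 0\<close> is exactly the case in which the reflected pair fails to be semistandard.
\<close>

section \<open>Counting functions of finite sets, and semistandardness as dominance\<close>

definition count_le :: "nat set \<Rightarrow> nat \<Rightarrow> nat" where
  "count_le S k = card (S \<inter> {..k})"

lemma count_le_Suc: "count_le S (Suc k) = count_le S k + (if Suc k \<in> S then 1 else 0)"
  by (simp add: count_le_def atMost_Suc)

lemma count_le_bound: "S \<subseteq> {..N} \<Longrightarrow> N \<le> k \<Longrightarrow> count_le S k = card S"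
  unfolding count_le_def by (rule arg_cong[of _ _ card]) auto

text \<open>On \<open>S\<close> itself the count is the rank of an element, starting from 1.
  Products and sums over \<open>S\<close> can therefore be reindexed by ranks.\<close>

lemma bij_betw_count_le:
  assumes "finite S"
  shows "bij_betw (count_le S) S {1..card S}"
proof -
  have less: "count_le S a < count_le S b" if "a \<in> S" "b \<in> S" "a < b" for a b
  proof -
    have "b \<in> S \<inter> {..b}" "b \<notin> S \<inter> {..a}" "S \<inter> {..a} \<subseteq> S \<inter> {..b}" using that by auto
    then have "S \<inter> {..a} \<subset> S \<inter> {..b}" by blast
    then show ?thesis unfolding count_le_def by (rule psubset_card_mono[rotated]) simp
  qed
  have inj: "inj_on (count_le S) S"
    by (rule linorder_inj_onI') (use less in fastforce)
  have sub: "count_le S ` S \<subseteq> {1..card S}"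
    using assms by (auto simp: count_le_def card_gt_0_iff Suc_le_eq intro!: card_mono)
  have "count_le S ` S = {1..card S}"
    by (rule card_subset_eq[OF _ sub]) (auto simp: card_image[OF inj])
  with inj show ?thesis by (simp add: bij_betw_def)
qed

text \<open>The elements up to \<open>k\<close> form an initial segment of the sorted list.
  Positions start at 0, hence the strict inequality on the right.\<close>

lemma sorted_list_nth_le_iff:
  assumes "finite S" "l < card S"
  shows "sorted_list_of_set S ! l \<le> k \<longleftrightarrow> l < count_le S k"
proof -
  let ?s = "sorted_list_of_set S"
  have len: "length ?s = card S" and set: "set ?s = S" using assms by auto
  have nth_less: "?s ! a < ?s ! b \<longleftrightarrow> a < b" if "a < card S" "b < card S" for a b
    by (metis len linorder_neqE_nat not_less_iff_gr_or_eq sorted_wrt_nth_less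
        strict_sorted_list_of_set that)
  let ?J = "{a. a < card S \<and> ?s ! a \<le> k}"
  have "S \<inter> {..k} = (!) ?s ` ?J"
    using set len by (force simp: in_set_conv_nth)
  moreover have "inj_on ((!) ?s) ?J"
    by (rule inj_onI) (metis (lifting) linorder_neqE_nat mem_Collect_eq nth_less less_irrefl)
  ultimately have c: "count_le S k = card ?J" by (simp add: count_le_def card_image)
  have down: "?s ! a \<le> ?s ! b" if "a \<le> b" "b < card S" for a b
    using nth_less[of b a] that by (simp add: not_less[symmetric])
  show ?thesis
  proof
    assume "?s ! l \<le> k"
    then have "{..l} \<subseteq> ?J" using down assms(2) by (auto intro: order_trans le_less_trans)
    then have "card {..l} \<le> card ?J" by (intro card_mono) auto
    then show "l < count_le S k" using c by simp
  next
    assume l: "l < count_le S k"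
    show "?s ! l \<le> k"
    proof (rule ccontr)
      assume n: "\<not> ?s ! l \<le> k"
      have "?J \<subseteq> {..<l}"
      proof
        fix a assume "a \<in> ?J"
        then show "a \<in> {..<l}" using n down[of l a] by (cases "a < l") auto
      qed
      then have "card ?J \<le> card {..<l}" by (intro card_mono) auto
      then show False using l c by simp
    qed
  qed
qed

definition dominates :: "column \<Rightarrow> column \<Rightarrow> bool" where
  "dominates D1 D2 \<longleftrightarrow> (\<forall>k. count_le D2 k \<le> count_le D1 k)"

lemma count_le_le_card: "finite S \<Longrightarrow> count_le S k \<le> card S"
  unfolding count_le_def by (rule card_mono) auto

text \<open>Entrywise comparison of sorted columns and pointwise comparison of counts are dual. The
  condition on cardinalities is the inequality at a \<open>k\<close> beyond all entries.\<close>

lemma semistandard_pair_iff_dominates: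
  assumes "finite D1" "finite D2"
  shows "semistandard_pair D1 D2 \<longleftrightarrow> dominates D1 D2"
proof
  assume s: "semistandard_pair D1 D2"
  show "dominates D1 D2"
    unfolding dominates_def
  proof
    fix k
    show "count_le D2 k \<le> count_le D1 k"
    proof (cases "count_le D2 k")
      case (Suc l)
      then have l: "l < count_le D2 k" by simp
      then have "l < card D2" using count_le_le_card[OF assms(2), of k] by simp
      with l s show ?thesis
        using sorted_list_nth_le_iff[OF assms(1), of l k] sorted_list_nth_le_iff[OF assms(2), of l k]
        by (fastforce simp: semistandard_pair_def Suc)
    qed simp
  qed
next
  assume d: "dominates D1 D2"
  obtain N where N: "D1 \<subseteq> {..N}" "D2 \<subseteq> {..N}"
    using finite_nat_iff_bounded_le[of "D1 \<union> D2"] assms by auto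
  have c: "card D2 \<le> card D1"
    using d count_le_bound[OF N(1), of N] count_le_bound[OF N(2), of N]
    by (metis dominates_def order_refl)
  have "sorted_list_of_set D1 ! l \<le> sorted_list_of_set D2 ! l" if "l < card D2" for l
  proof -
    \<comment> \<open>The threshold at which dominance is applied is the \<open>l\<close>-th entry
      of \<open>D2\<close> itself.\<close>
    have "l < count_le D2 (sorted_list_of_set D2 ! l)"
      using sorted_list_nth_le_iff[OF assms(2) that] by blast
    also have "\<dots> \<le> count_le D1 (sorted_list_of_set D2 ! l)"
      using d by (simp add: dominates_def)
    finally show ?thesis using sorted_list_nth_le_iff[OF assms(1)] that c by simp
  qed
  with c show "semistandard_pair D1 D2" by (simp add: semistandard_pair_def)
qed

section \<open>Effect of a reflection on counts and on dominance\<close>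

lemma mem_reflect_iff: "a \<in> reflect j D \<longleftrightarrow> transpose j (j + 1) a \<in> D"
proof
  assume "transpose j (j + 1) a \<in> D"
  then show "a \<in> reflect j D" unfolding reflect_def by (rule rev_image_eqI) simp
qed (auto simp: reflect_def)

lemma card_reflect [simp]: "card (reflect j D) = card D"
  unfolding reflect_def by (intro card_image inj_on_subset[OF inj_transpose]) simp

text \<open>For \<open>k < j\<close> both swapped letters lie outside \<open>{..k}\<close>, for
  \<open>k > j\<close> both lie inside; only the count at \<open>j\<close> can change.\<close>

lemma count_le_reflect:
  assumes "k \<noteq> j"
  shows "count_le (reflect j D) k = count_le D k"
proof -
  have "reflect j D \<inter> {..k} = transpose j (j + 1) ` (D \<inter> {..k})"
    using assms by (auto simp: reflect_def transpose_def image_iff split: if_splits)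
  then show ?thesis by (simp add: count_le_def card_image inj_transpose)
qed

lemma count_le_reflect_same:
  assumes "1 \<le> j"
  shows "count_le (reflect j D) j = count_le D (j - 1) + (if j + 1 \<in> D then 1 else 0)"
  using count_le_Suc[of "reflect j D" "j - 1"] count_le_reflect[of "j - 1" j D] assms
  by (simp add: mem_reflect_iff)

lemma count_le_pred:
  assumes "1 \<le> j"
  shows "count_le D j = count_le D (j - 1) + (if j \<in> D then 1 else 0)"
    and "count_le D (j + 1) = count_le D j + (if j + 1 \<in> D then 1 else 0)"
  using count_le_Suc[of D "j - 1"] count_le_Suc[of D j] assms by auto

text \<open>Only the inequality at \<open>j\<close> has to be checked again. There the first column
  has lost \<open>j\<close>, so its count falls to that at \<open>j - 1\<close>, while a decreased
  second column gains one over its count at \<open>j - 1\<close>.\<close>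

lemma dominates_reflect_iff:
  assumes "1 \<le> j" "increases j D1" "dominates D1 D2"
  shows "dominates (reflect j D1) (reflect j D2) \<longleftrightarrow>
    (decreases j D2 \<longrightarrow> count_le D2 (j - 1) < count_le D1 (j - 1))"
proof -
  have D: "count_le D2 k \<le> count_le D1 k" for k using assms(3) by (simp add: dominates_def)
  note c = count_le_pred[OF assms(1), of D1] count_le_pred[OF assms(1), of D2]
  have "dominates (reflect j D1) (reflect j D2) \<longleftrightarrow>
      count_le (reflect j D2) j \<le> count_le (reflect j D1) j"
    unfolding dominates_def using D count_le_reflect by metis
  also have "\<dots> \<longleftrightarrow> (decreases j D2 \<longrightarrow> count_le D2 (j - 1) < count_le D1 (j - 1))"
    \<comment> \<open>The inequality at \<open>j + 1\<close> is what settles the case where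
      \<open>D2\<close> contains both \<open>j\<close> and \<open>j + 1\<close>.\<close>
    using assms(2) D[of "j - 1"] D[of "j + 1"] c
    unfolding count_le_reflect_same[OF assms(1)]
    by (auto simp: increases_def decreases_def)
  finally show ?thesis .
qed

text \<open>At \<open>j\<close> both counts equal those at \<open>j - 1\<close>, as neither column
  contains \<open>j\<close>. Thus the child along an \<open>Id_plus\<close> edge is again a
  semistandard pair.\<close>

lemma dominates_reflect_left:
  assumes "1 \<le> j" "increases j D1" "decreases j D2" "dominates D1 D2"
  shows "dominates (reflect j D1) D2"
proof -
  have D: "count_le D2 k \<le> count_le D1 k" for k using assms(4) by (simp add: dominates_def)
  note c = count_le_pred[OF assms(1), of D1] count_le_pred[OF assms(1), of D2]
  have "count_le D2 j \<le> count_le (reflect j D1) j"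
    using assms(2,3) D[of "j - 1"]
    by (auto simp: count_le_reflect_same[OF assms(1)] c increases_def decreases_def)
  then show ?thesis unfolding dominates_def using D count_le_reflect by metis
qed

section \<open>The product of gap factors and its change under reflections\<close>

definition gap_weight :: "column \<Rightarrow> column \<Rightarrow> ratfun \<Rightarrow> nat \<Rightarrow> ratfun" where
  "gap_weight D1 D2 x u = 1 - x ^ (count_le D1 u - count_le D2 u)"

definition gap_prod :: "column \<Rightarrow> column \<Rightarrow> ratfun \<Rightarrow> ratfun" where
  "gap_prod D1 D2 x = (\<Prod>u\<in>D1 - D2. gap_weight D1 D2 x u)"

text \<open>Away from \<open>j\<close> and \<open>j + 1\<close> nothing changes. If \<open>j\<close>
  is in \<open>D2\<close>, neither product has a factor at these two letters; otherwise the factor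
  at \<open>j\<close> moves to \<open>j + 1\<close> with the same gap.\<close>

lemma gap_prod_reflect:
  assumes "finite D1" "1 \<le> j" "increases j D1" "\<not> decreases j D2"
  shows "gap_prod (reflect j D1) (reflect j D2) x = gap_prod D1 D2 x"
proof -
  let ?K = "D1 - D2 - {j, j + 1}"
  let ?w = "gap_weight D1 D2 x"
  let ?w' = "gap_weight (reflect j D1) (reflect j D2) x"
  have w: "?w' u = ?w u" if "u \<noteq> j" for u
    using that by (simp add: gap_weight_def count_le_reflect)
  have K: "prod ?w' ?K = prod ?w ?K" by (rule prod.cong) (auto simp: w)
  show ?thesis
  proof (cases "j \<in> D2")
    case True
    then have "D1 - D2 = ?K" "reflect j D1 - reflect j D2 = ?K"
      using assms(3,4) by (auto simp: increases_def decreases_def mem_reflect_iff transpose_def split: if_splits)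
    then show ?thesis using K unfolding gap_prod_def by simp
  next
    case False
    then have S: "D1 - D2 = insert j ?K" "reflect j D1 - reflect j D2 = insert (j + 1) ?K"
      using assms(3,4) by (auto simp: increases_def decreases_def mem_reflect_iff transpose_def split: if_splits)
    have "?w' (j + 1) = ?w j"
      using False assms(3,4) count_le_pred[OF assms(2), of D1] count_le_pred[OF assms(2), of D2]
      by (simp add: gap_weight_def count_le_reflect increases_def decreases_def)
    moreover have "prod ?w (D1 - D2) = ?w j * prod ?w ?K"
      by (subst S(1), rule prod.insert) (use assms(1) in auto)
    moreover have "prod ?w' (reflect j D1 - reflect j D2) = ?w' (j + 1) * prod ?w' ?K"
      by (subst S(2), rule prod.insert) (use assms(1) in auto)
    ultimately show ?thesis using K by (simp only: gap_prod_def)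
  qed
qed

text \<open>The pair reached by the \<open>Id_plus\<close> edge has no factor at \<open>j\<close> or
  \<open>j + 1\<close>, since \<open>j + 1\<close> cancels against \<open>D2\<close>. The root pair
  has one extra factor at \<open>j\<close>, the reflected pair one at \<open>j + 1\<close>, so both
  are multiples of its product.\<close>

lemma gap_prod_decreases:
  assumes "finite D1" "1 \<le> j" "increases j D1" "decreases j D2" "dominates D1 D2"
  defines "d \<equiv> count_le D1 (j - 1) - count_le D2 (j - 1)"
  shows "gap_prod D1 D2 x = (1 - x ^ Suc d) * gap_prod (reflect j D1) D2 x"
    and "gap_prod (reflect j D1) (reflect j D2) x = (1 - x ^ d) * gap_prod (reflect j D1) D2 x"
proof -
  let ?K = "D1 - D2 - {j, j + 1}"
  have le: "count_le D2 (j - 1) \<le> count_le D1 (j - 1)" using assms(5) by (simp add: dominates_def)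
  have K: "prod (gap_weight (reflect j D1) (reflect j D2) x) ?K = prod (gap_weight D1 D2 x) ?K"
    "prod (gap_weight (reflect j D1) D2 x) ?K = prod (gap_weight D1 D2 x) ?K"
    by (intro prod.cong; auto simp: gap_weight_def count_le_reflect)+
  have S: "D1 - D2 = insert j ?K" "reflect j D1 - reflect j D2 = insert (j + 1) ?K"
    "reflect j D1 - D2 = ?K"
    using assms(3,4) by (auto simp: increases_def decreases_def mem_reflect_iff transpose_def split: if_splits)
  \<comment> \<open>Dominance at \<open>j - 1\<close> makes the truncated subtraction exact, which
    gives \<open>Suc d\<close> at \<open>j\<close>; at \<open>j + 1\<close> each reflected column
    has gained one element over \<open>j - 1\<close>, which leaves \<open>d\<close>.\<close>
  have w: "gap_weight D1 D2 x j = 1 - x ^ Suc d"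
    "gap_weight (reflect j D1) (reflect j D2) x (j + 1) = 1 - x ^ d"
    using assms(3,4) le count_le_pred[OF assms(2), of D1] count_le_pred[OF assms(2), of D2]
    by (simp_all add: gap_weight_def count_le_reflect increases_def decreases_def d_def Suc_diff_le)
  show "gap_prod D1 D2 x = (1 - x ^ Suc d) * gap_prod (reflect j D1) D2 x"
    unfolding gap_prod_def S(3) K(2) w(1)[symmetric]
    by (subst S(1), rule prod.insert) (use assms(1) in auto)
  show "gap_prod (reflect j D1) (reflect j D2) x = (1 - x ^ d) * gap_prod (reflect j D1) D2 x"
    unfolding gap_prod_def S(3) K(2) w(2)[symmetric] K(1)[symmetric]
    by (subst S(2), rule prod.insert) (use assms(1) in auto)
qed

text \<open>For nested columns the gap at \<open>u\<close> is the rank of \<open>u\<close> in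
  \<open>D1 - D2\<close>, so the gaps run through 1, 2, and so on. This serves the final vertices,
  and with \<open>D2 = {}\<close> the last column.\<close>

lemma gap_prod_subset:
  assumes "finite D1" "D2 \<subseteq> D1"
  shows "gap_prod D1 D2 x = phi (card D1 - card D2) x"
proof -
  have f: "finite (D1 - D2)" "finite D2" using assms finite_subset by auto
  have "count_le D1 u - count_le D2 u = count_le (D1 - D2) u" for u
  proof -
    have "card (D1 \<inter> {..u} - D2 \<inter> {..u}) = count_le D1 u - count_le D2 u"
      unfolding count_le_def by (rule card_Diff_subset) (use assms in auto)
    moreover have "D1 \<inter> {..u} - D2 \<inter> {..u} = (D1 - D2) \<inter> {..u}" by auto
    ultimately show ?thesis by (simp add: count_le_def)
  qed
  then have "gap_prod D1 D2 x = (\<Prod>u\<in>D1 - D2. 1 - x ^ count_le (D1 - D2) u)"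
    by (simp add: gap_prod_def gap_weight_def)
  also have "\<dots> = phi (card (D1 - D2)) x"
    unfolding phi_def by (rule prod.reindex_bij_betw[OF bij_betw_count_le[OF f(1)]])
  also have "card (D1 - D2) = card D1 - card D2" by (rule card_Diff_subset[OF f(2) assms(2)])
  finally show ?thesis .
qed

text \<open>A final column is closed upwards in the alphabet. If it misses a letter \<open>a\<close>
  of \<open>D2\<close>, it has no letter up to \<open>a\<close>, against dominance at
  \<open>a\<close>.\<close>

lemma dominates_final_subset:
  assumes "D1 \<subseteq> {1..n + 1}" "D2 \<subseteq> {1..n + 1}" "final_column n D1" "dominates D1 D2"
  shows "D2 \<subseteq> D1"
proof
  fix a assume a: "a \<in> D2"
  show "a \<in> D1"
  proof (rule ccontr)
    assume n: "a \<notin> D1"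
    have "b \<notin> D1" if "b \<le> a" for b
    proof
      assume "b \<in> D1"
      with n that a assms(2) have "(b, a) \<in> col_inv n D1"
        by (cases "b = a") (auto simp: col_inv_def)
      then show False using final_column_iff[OF assms(1)] assms(3) by simp
    qed
    then have "count_le D1 a = 0" by (auto simp: count_le_def intro!: card_eq_0_iff[THEN iffD2])
    moreover have "0 < count_le D2 a" using a by (auto simp: count_le_def card_gt_0_iff)
    ultimately show False using assms(4) by (metis dominates_def not_less)
  qed
qed

section \<open>The indeterminate and its inverse\<close>

lemma q_nonzero: "q \<noteq> 0"
  by (simp add: q_def Zero_fract_def eq_fract)

lemma q_mult_t: "q * t = 1"
  by (simp add: t_def q_nonzero)

lemma q_power: "q ^ l = Fract ([:0, 1:] ^ l) 1"
  by (induction l) (simp_all add: q_def One_fract_def)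

text \<open>Comparison of degrees in \<open>q\<close> excludes equality; this makes every
  denominator \<open>phi k t\<close> invertible.\<close>

lemma t_power_neq_1:
  assumes "0 < l"
  shows "t ^ l \<noteq> 1"
proof
  assume "t ^ l = 1"
  then have "q ^ l = 1" by (simp add: t_def power_inverse)
  then have "[:0, 1:] ^ l = (1 :: rat poly)" by (simp add: q_power One_fract_def eq_fract)
  then have "degree ([:0, 1 :: rat:] ^ l) = 0" by simp
  then show False using assms by (simp add: degree_power_eq)
qed

lemma phi_t_nonzero: "phi k t \<noteq> 0"
  using t_power_neq_1 by (auto simp: phi_def)

lemma t_powi_neg: "t powi (- int k) = q ^ k"
  by (simp add: t_def power_int_minus power_inverse)

section \<open>Recursion for the path sum, and its solution\<close>

definition edge_weight :: "edge_label \<Rightarrow> ratfun" where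
  "edge_weight e = (case e of S_plus j \<Rightarrow> q | S_minus j \<Rightarrow> 1 | Id_plus j \<Rightarrow> q - 1)"

lemma contrib2_final:
  assumes "final_column n D1"
  shows "contrib2 n ch D1 D2 = 1"
proof -
  have "es = []" if "tree_path n ch (D1, D2) es" for es
    using that
  proof cases
    case (step e w es')
    from step(2) assms show ?thesis by cases auto
  qed
  then have "{es. tree_path n ch (D1, D2) es} = {[]}"
    using tree_path.stop[OF assms] by blast
  then show ?thesis by (simp add: contrib2_def pr_def pf_def)
qed

text \<open>Paths are sorted by their first edge, and the weight of a path is multiplicative over
  its edges. The edge set is a parameter so that an explicit description can be substituted for
  it.\<close>

lemma contrib2_step:
  assumes ch: "admissible_choice n ch" and D1: "D1 \<subseteq> {1..n + 1}" and nf: "\<not> final_column n D1"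
    and E: "{(e, w). tree_edge n ch (D1, D2) e w} = E" "finite E"
  shows "contrib2 n ch D1 D2 =
    (\<Sum>(e, w)\<in>E. edge_weight e * contrib2 n ch (fst w) (snd w))"
proof -
  let ?P = "\<lambda>w. {es. tree_path n ch w es}"
  let ?f = "\<lambda>es. q ^ pr es * (q - 1) ^ pf es"
  have j: "ch D1 \<in> {1..n}" "increases (ch D1) D1"
    using ch D1 nf by (auto simp: admissible_choice_def)
  have fin: "finite (?P w)" if "(e, w) \<in> E" for e w
  proof -
    from that have "tree_edge n ch (D1, D2) e w" using E by auto
    then have "fst w = reflect (ch D1) D1" by cases auto
    then have "fst w \<subseteq> {1..n + 1}" using reflect_subset[OF D1 j(1)] by simp
    from finite_tree_paths[OF ch this, of "snd w"] show ?thesis by simp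
  qed
  have "?P (D1, D2) = (\<Union>x\<in>E. (#) x ` ?P (snd x))"
  proof (intro equalityI subsetI)
    fix es assume "es \<in> ?P (D1, D2)"
    then have "tree_path n ch (D1, D2) es" by simp
    then show "es \<in> (\<Union>x\<in>E. (#) x ` ?P (snd x))"
      by cases (use nf E in force)+
  next
    fix es assume "es \<in> (\<Union>x\<in>E. (#) x ` ?P (snd x))"
    then show "es \<in> ?P (D1, D2)" using E(1) by (auto intro: tree_path.step)
  qed
  then have "contrib2 n ch D1 D2 = (\<Sum>x\<in>E. sum ?f ((#) x ` ?P (snd x)))"
    unfolding contrib2_def using E(2) fin by (simp only:) (subst sum.UNION_disjoint; auto)
  also have "\<dots> = (\<Sum>(e, w)\<in>E. edge_weight e * contrib2 n ch (fst w) (snd w))"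
  proof (rule sum.cong; clarify)
    fix e D1' D2'
    \<comment> \<open>An \<open>S_minus\<close> edge is counted by neither \<open>pr\<close> nor
      \<open>pf\<close>, hence its weight 1.\<close>
    have "?f ((e, w) # es) = edge_weight e * ?f es" for w es
      by (cases e) (simp_all add: edge_weight_def pr_def pf_def)
    then show "sum ?f ((#) (e, D1', D2') ` ?P (snd (e, D1', D2'))) =
        edge_weight e * contrib2 n ch (fst (D1', D2')) (snd (D1', D2'))"
      by (simp add: sum.reindex contrib2_def sum_distrib_left)
  qed
  finally show ?thesis .
qed

lemma contrib2_recursion:
  assumes "admissible_choice n ch" "D1 \<subseteq> {1..n + 1}" "\<not> final_column n D1"
  defines "j \<equiv> ch D1"
  shows "contrib2 n ch D1 D2 =
    (if semistandard_pair (reflect j D1) (reflect j D2)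
     then if decreases j D2
       then contrib2 n ch (reflect j D1) (reflect j D2) + (q - 1) * contrib2 n ch (reflect j D1) D2
       else q * contrib2 n ch (reflect j D1) (reflect j D2)
     else (q - 1) * contrib2 n ch (reflect j D1) D2)"
proof -
  let ?E = "if semistandard_pair (reflect j D1) (reflect j D2)
    then if decreases j D2
      then {(S_minus j, reflect j D1, reflect j D2), (Id_plus j, reflect j D1, D2)}
      else {(S_plus j, reflect j D1, reflect j D2)}
    else {(Id_plus j, reflect j D1, D2)}"
  have E: "{(e, w). tree_edge n ch (D1, D2) e w} = ?E"
    using assms(3) by (auto simp: tree_edge.simps j_def)
  show ?thesis
    by (subst contrib2_step[OF assms(1-3) E]) (auto simp: edge_weight_def)
qed

text \<open>Without division the claim is linear in the path sums, and the factor \<open>phi\<close>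
  is constant along the tree because reflections preserve cardinalities. The induction is on the
  inversions of the first column, with the second column arbitrary.\<close>

lemma contrib2_eq_gap_prod:
  assumes "admissible_choice n ch" "D1 \<subseteq> {1..n + 1}" "D2 \<subseteq> {1..n + 1}" "dominates D1 D2"
  shows "contrib2 n ch D1 D2 * phi (card D1 - card D2) t =
    q ^ card (col_inv n D1) * gap_prod D1 D2 t"
  using assms(2-)
proof (induction "card (col_inv n D1)" arbitrary: D1 D2 rule: less_induct)
  case less
  have fin: "finite D1" "finite D2" using less.prems finite_subset by blast+
  show ?case
  proof (cases "final_column n D1")
    \<comment> \<open>At a final vertex the path sum is 1, no inversion remains, and the gap product
      is the factor \<open>phi\<close>.\<close>
    case True
    then show ?thesis
      using gap_prod_subset[OF fin(1) dominates_final_subset[OF less.prems(1,2) True less.prems(3)]]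
        final_column_iff[OF less.prems(1)]
      by (simp add: contrib2_final)
  next
    case False
    let ?j = "ch D1"
    let ?A = "reflect ?j D1"
    let ?B = "reflect ?j D2"
    let ?phi = "phi (card D1 - card D2) t"
    have j: "?j \<in> {1..n}" "increases ?j D1" "1 \<le> ?j"
      using assms(1) less.prems False by (auto simp: admissible_choice_def)
    note rec = contrib2_recursion[OF assms(1) less.prems(1) False, of D2]
    have sub: "?A \<subseteq> {1..n + 1}" "?B \<subseteq> {1..n + 1}"
      using reflect_subset j(1) less.prems by blast+
    have finr: "finite ?A" "finite ?B" using sub finite_subset by blast+
    have inv: "card (col_inv n D1) = Suc (card (col_inv n ?A))"
      by (rule col_inv_reflect[OF less.prems(1) j(1,2)])
    have IH: "contrib2 n ch ?A X * phi (card D1 - card X) t =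
        q ^ card (col_inv n ?A) * gap_prod ?A X t"
      if "X \<subseteq> {1..n + 1}" "dominates ?A X" for X
      using less.hyps[of ?A X] inv sub(1) that by simp
    have ss: "semistandard_pair ?A ?B \<longleftrightarrow> dominates ?A ?B"
      by (rule semistandard_pair_iff_dominates[OF finr])
    note dom = dominates_reflect_iff[OF j(3,2) less.prems(3)]
    show ?thesis
    proof (cases "decreases ?j D2")
      \<comment> \<open>Only an \<open>S_plus\<close> edge leaves the vertex; its factor
        \<open>q\<close> accounts for the lost inversion.\<close>
      case nd: False
      then have "dominates ?A ?B" using dom by simp
      then show ?thesis
        using IH[OF sub(2)] nd gap_prod_reflect[OF fin(1) j(3,2) nd, of t]
        by (simp add: rec ss inv mult.assoc)
    next
      case dec: True
      define d where "d = count_le D1 (?j - 1) - count_le D2 (?j - 1)"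
      define c where "c = q ^ card (col_inv n ?A) * gap_prod ?A D2 t"
      note gp = gap_prod_decreases[OF fin(1) j(3,2) dec less.prems(3), folded d_def]
      have left: "contrib2 n ch ?A D2 * ?phi = c"
        unfolding c_def
        by (rule IH[OF less.prems(2) dominates_reflect_left[OF j(3,2) dec less.prems(3)]])
      have both: "contrib2 n ch ?A ?B * ?phi = (1 - t ^ d) * c" if "dominates ?A ?B"
        using IH[OF sub(2) that] gp(2)[of t] by (simp add: c_def)
      \<comment> \<open>If the reflected pair is not semistandard, the term with
        \<open>1 - t ^ d\<close> vanishes, so one formula covers both cases below.\<close>
      have fail: "d = 0" if "\<not> dominates ?A ?B"
        using that dom dec by (simp add: d_def)
      have "contrib2 n ch D1 D2 * ?phi = (1 - t ^ d) * c + (q - 1) * c"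
        using left both fail dec by (cases "dominates ?A ?B") (simp_all add: rec ss distrib_right mult.assoc)
      \<comment> \<open>By \<open>q * t = 1\<close>, both coefficients of \<open>c\<close> equal
        \<open>q - t ^ d\<close>.\<close>
      also have "\<dots> = q * (1 - t ^ Suc d) * c"
        using q_mult_t by (simp add: algebra_simps flip: mult.assoc)
      also have "\<dots> = q ^ card (col_inv n D1) * gap_prod D1 D2 t"
        using gp(1)[of t] by (simp add: c_def inv)
      finally show ?thesis .
    qed
  qed
qed

section \<open>The pairing with \<open>rho\<close> as an inversion count\<close>

text \<open>Above a letter \<open>a\<close> of \<open>C\<close> there are \<open>n + 1 - a\<close>
  letters, of which \<open>card C\<close> minus the rank of \<open>a\<close> belong to
  \<open>C\<close>. Summing over \<open>C\<close> turns the ranks into 1, ...,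
  \<open>card C\<close>.\<close>

lemma col_pairing_eq_card_col_inv:
  assumes "C \<subseteq> {1..n + 1}"
  shows "col_pairing n C = real (card (col_inv n C))"
proof -
  have fC: "finite C" using assms finite_subset by blast
  have m: "card C \<le> n + 1" using card_mono[OF _ assms] by simp
  have half: "(\<Sum>a\<in>S. (real n + 2 - 2 * real a) / 2) =
      real (card S) * ((real n + 2) / 2) - (\<Sum>a\<in>S. real a)" for S
    by (simp add: diff_divide_distrib sum_subtractf)
  have "col_pairing n C =
      inner_prod n (\<lambda>k. \<Sum>a\<in>{1..card C}. basis_vec a k) (rho n) +
      inner_prod n (\<lambda>k. \<Sum>a\<in>C. basis_vec a k) (rho n)"
    by (simp add: col_pairing_def col_shape_def col_content_def inner_prod_def
        distrib_right sum.distrib)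
  also have "\<dots> = real (card C) * (real n + 2) - (\<Sum>l = 1..card C. real l) - (\<Sum>a\<in>C. real a)"
    using m assms half[of "{1..card C}"] half[of C]
    by (subst (1 2) inner_prod_basis_sum) (auto simp: field_simps)
  finally have pairing: "col_pairing n C = \<dots>" .
  have "col_inv n C = Sigma C (\<lambda>a. {a<..n + 1} - C)"
    using assms by (auto simp: col_inv_def)
  then have "real (card (col_inv n C)) = (\<Sum>a\<in>C. real (card ({a<..n + 1} - C)))"
    using fC by simp
  also have "\<dots> = (\<Sum>a\<in>C. real n + 1 - real (card C) - real a + real (count_le C a))"
  proof (rule sum.cong[OF refl])
    fix a assume a: "a \<in> C"
    have "{a<..n + 1} - C = {a<..n + 1} - (C - {..a})" by auto
    then have "card ({a<..n + 1} - C) = card {a<..n + 1} - card (C - {..a})"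
      using fC assms by (subst card_Diff_subset[symmetric]) auto
    moreover have "card (C - {..a}) \<le> card {a<..n + 1}"
      using assms by (intro card_mono) auto
    moreover have "card (C - {..a}) + count_le C a = card C"
      using card_Diff_subset_Int[of C "{..a}"] count_le_le_card[OF fC, of a] fC
      by (simp add: count_le_def)
    moreover have "a \<le> n + 1" using a assms by auto
    ultimately show "real (card ({a<..n + 1} - C)) =
        real n + 1 - real (card C) - real a + real (count_le C a)"
      by simp
  qed
  also have "\<dots> = real (card C) * (real n + 1 - real (card C)) - (\<Sum>a\<in>C. real a)
      + (\<Sum>a\<in>C. real (count_le C a))"
    by (simp add: sum.distrib sum_subtractf algebra_simps)
  also have "(\<Sum>a\<in>C. real (count_le C a)) = (\<Sum>l = 1..card C. real l)"
    by (rule sum.reindex_bij_betw[OF bij_betw_count_le[OF fC]])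
  finally have inv: "real (card (col_inv n C)) = real (card C) * (real n + 1 - real (card C))
      - (\<Sum>a\<in>C. real a) + (\<Sum>l = 1..card C. real l)" .
  \<comment> \<open>The two expressions differ by \<open>m * (m + 1)\<close> minus twice the sum 1 +
    ... + m, where \<open>m = card C\<close>.\<close>
  have "2 * (\<Sum>l = 1..k. real l) = real k * (real k + 1)" for k
    by (induction k) (simp_all add: algebra_simps)
  from this[of "card C"] show ?thesis unfolding pairing inv by (simp add: algebra_simps)
qed

text \<open>The pairing is a natural number, so the floor is exact.\<close>

lemma t_powi_col_pairing:
  assumes "C \<subseteq> {1..n + 1}"
  shows "t powi (- \<lfloor>col_pairing n C\<rfloor>) = q ^ card (col_inv n C)"
  by (simp add: col_pairing_eq_card_col_inv[OF assms] t_powi_neg)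

section \<open>Columns and heads in a semistandard tableau\<close>

lemma tab_column_subset:
  assumes "semistandard_tableau n lam T"
  shows "tab_column lam T i \<subseteq> {1..n + 1}"
  using assms by (fastforce simp: semistandard_tableau_def young_tableau_def tab_column_def)

lemma boxes_closed:
  assumes "semistandard_tableau n lam T" "(j, i) \<in> boxes lam" "j' \<le> j" "i' \<le> i"
  shows "(j', i') \<in> boxes lam"
proof -
  have "sorted_wrt (\<ge>) lam"
    using assms(1) by (simp add: semistandard_tableau_def young_tableau_def is_partition_def)
  then have "lam ! j \<le> lam ! j'"
    using assms(2,3) by (cases "j' = j") (auto simp: boxes_def sorted_wrt_iff_nth_less)
  then show ?thesis using assms by (auto simp: boxes_def)
qed

context
  fixes n :: nat and lam :: "nat list" and T :: filling
  assumes ss: "semistandard_tableau n lam T"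
begin

lemma column_less_iff:
  assumes "(j, i) \<in> boxes lam" "(j', i) \<in> boxes lam"
  shows "T j i < T j' i \<longleftrightarrow> j < j'"
proof -
  have "T a i < T b i" if "(a, i) \<in> boxes lam" "(b, i) \<in> boxes lam" "a < b" for a b
    using ss that unfolding semistandard_tableau_def young_tableau_def by blast
  with assms show ?thesis by (metis less_asym less_irrefl linorder_neqE_nat)
qed

lemma column_le_iff:
  assumes "(j, i) \<in> boxes lam" "(j', i) \<in> boxes lam"
  shows "T j i \<le> T j' i \<longleftrightarrow> j \<le> j'"
  using column_less_iff[OF assms(2,1)] by (simp add: not_less[symmetric])

lemma row_le:
  assumes "(j, Suc i) \<in> boxes lam"
  shows "T j i \<le> T j (Suc i)"
proof -
  have "(j, i) \<in> boxes lam" using boxes_closed[OF ss assms] by simp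
  then show ?thesis using ss assms unfolding semistandard_tableau_def by blast
qed

lemma column_inj: "inj_on (\<lambda>j. T j i) {j. (j, i) \<in> boxes lam}"
  by (rule linorder_inj_onI') (use column_less_iff in fastforce)

lemma count_le_tab_column:
  "count_le (tab_column lam T i) k = card {j. (j, i) \<in> boxes lam \<and> T j i \<le> k}"
proof -
  have "tab_column lam T i \<inter> {..k} = (\<lambda>j. T j i) ` {j. (j, i) \<in> boxes lam \<and> T j i \<le> k}"
    by (auto simp: tab_column_def)
  moreover have "inj_on (\<lambda>j. T j i) {j. (j, i) \<in> boxes lam \<and> T j i \<le> k}"
    by (rule inj_on_subset[OF column_inj]) auto
  ultimately show ?thesis by (simp add: count_le_def card_image)
qed

lemma finite_column_rows: "finite {j. (j, i) \<in> boxes lam \<and> P j}"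
  by (rule finite_subset[of _ "{..<length lam}"]) (auto simp: boxes_def)

text \<open>A row whose entry in the right column is at most \<open>k\<close> also has its left
  entry at most \<open>k\<close>, so the rows counted on the right are among those counted on the
  left.\<close>

lemma dominates_tab_column: "dominates (tab_column lam T i) (tab_column lam T (Suc i))"
  unfolding dominates_def count_le_tab_column
  by (intro allI card_mono finite_column_rows)
    (auto intro: boxes_closed[OF ss] dest: row_le)

lemma count_le_tab_column_entry:
  assumes "(j, i) \<in> boxes lam"
  shows "count_le (tab_column lam T i) (T j i) = Suc j"
proof -
  have "{j'. (j', i) \<in> boxes lam \<and> T j' i \<le> T j i} = {..j}"
    using assms boxes_closed[OF ss assms] column_le_iff by auto
  then show ?thesis by (simp add: count_le_tab_column)
qed

text \<open>The row bound in the head excludes no equal entry: weakly increasing rows and strictly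
  increasing columns force an equal entry of the next column into a row at most \<open>j\<close>. An
  added box with infinity never equals a letter.\<close>

lemma head_avoids_entry_iff:
  assumes "(j, i) \<in> boxes lam"
  shows "(\<forall>v\<in>head lam T (j, i). aug_entry lam T v \<noteq> aug_entry lam T (j, i)) \<longleftrightarrow>
    T j i \<notin> tab_column lam T (Suc i)"
proof -
  have u: "aug_entry lam T (j, i) = enat (T j i)" using assms by (auto simp: aug_entry_def boxes_def)
  have "(\<exists>v\<in>head lam T (j, i). aug_entry lam T v = aug_entry lam T (j, i)) \<longleftrightarrow>
      (\<exists>j'. (j', Suc i) \<in> boxes lam \<and> T j' (Suc i) = T j i)"
  proof
    assume "\<exists>v\<in>head lam T (j, i). aug_entry lam T v = aug_entry lam T (j, i)"
    then obtain v where v: "v \<in> head lam T (j, i)" "aug_entry lam T v = enat (T j i)"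
      unfolding u by blast
    then have "v = (fst v, Suc i)" "v \<in> boxes lam" "T (fst v) (Suc i) = T j i"
      by (auto simp: head_def aug_boxes_def boxes_def aug_entry_def split: if_splits)
    then show "\<exists>j'. (j', Suc i) \<in> boxes lam \<and> T j' (Suc i) = T j i" by metis
  next
    assume "\<exists>j'. (j', Suc i) \<in> boxes lam \<and> T j' (Suc i) = T j i"
    then obtain j' where j': "(j', Suc i) \<in> boxes lam" "T j' (Suc i) = T j i" by blast
    have "(j', i) \<in> boxes lam" using boxes_closed[OF ss j'(1)] by simp
    then have "j' \<le> j" using column_le_iff[OF _ assms] row_le[OF j'(1)] j'(2) by simp
    then have "(j', Suc i) \<in> head lam T (j, i)" "aug_entry lam T (j', Suc i) = enat (T j i)"
      using j' assms by (auto simp: u head_def aug_boxes_def boxes_def aug_entry_def)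
    then show "\<exists>v\<in>head lam T (j, i). aug_entry lam T v = aug_entry lam T (j, i)"
      unfolding u by blast
  qed
  then show ?thesis by (auto simp: tab_column_def)
qed

text \<open>Each of the \<open>j + 1\<close> rows down to row \<open>j\<close> offers one box of the
  augmented next column; exactly those with an entry at most \<open>T j i\<close> drop out. Equality
  is excluded by assumption, so the others are the head.\<close>

lemma card_head:
  assumes "(j, i) \<in> boxes lam" "T j i \<notin> tab_column lam T (Suc i)"
  shows "card (head lam T (j, i)) =
    count_le (tab_column lam T i) (T j i) - count_le (tab_column lam T (Suc i)) (T j i)"
proof -
  let ?R = "{j'. (j', Suc i) \<in> boxes lam \<and> T j' (Suc i) \<le> T j i}"
  have R: "?R \<subseteq> {..j}"
  proof
    fix j' assume j': "j' \<in> ?R"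
    then have "(j', i) \<in> boxes lam" using boxes_closed[OF ss, of j' "Suc i" j' i] by simp
    then show "j' \<in> {..j}" using column_le_iff[OF _ assms(1)] row_le[of j' i] j' by fastforce
  qed
  \<comment> \<open>Row \<open>j'\<close> has a box in column \<open>i\<close>, so column
    \<open>Suc i\<close> has a box there too, possibly the added one.\<close>
  have aug: "(j', Suc i) \<in> aug_boxes lam" if "j' \<le> j" for j'
    using boxes_closed[OF ss assms(1) that order_refl] by (auto simp: aug_boxes_def boxes_def)
  have entry: "aug_entry lam T (j, i) \<le> aug_entry lam T (j', Suc i) \<longleftrightarrow> j' \<notin> ?R"
    if "j' \<le> j" for j'
  proof -
    have ne: "T j' (Suc i) \<noteq> T j i" if "(j', Suc i) \<in> boxes lam"
      using that assms(2) by (auto simp: tab_column_def)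
    have "j' < length lam" using aug[OF that] by (simp add: aug_boxes_def)
    then show ?thesis
      using assms(1) ne by (auto simp: aug_entry_def boxes_def)
  qed
  have "head lam T (j, i) = (\<lambda>j'. (j', Suc i)) ` ({..j} - ?R)"
    using aug entry by (auto simp: head_def)
  then have "card (head lam T (j, i)) = card ({..j} - ?R)"
    by (simp add: card_image inj_on_def)
  also have "\<dots> = Suc j - card ?R"
    using R by (subst card_Diff_subset) (auto intro: finite_subset)
  finally show ?thesis
    using count_le_tab_column_entry[OF assms(1)] by (simp add: count_le_tab_column)
qed

text \<open>Boxes are reindexed first by row and then by entry, which is injective on a
  column.\<close>

lemma phi_col_eq_gap_prod:
  "phi_col lam T i x = gap_prod (tab_column lam T i) (tab_column lam T (Suc i)) x"
proof -
  let ?D = "tab_column lam T i" and ?D' = "tab_column lam T (Suc i)"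
  let ?J = "{j. (j, i) \<in> boxes lam \<and> T j i \<notin> ?D'}"
  have "{u. u \<in> boxes lam \<and> snd u = i \<and>
      (\<forall>v\<in>head lam T u. aug_entry lam T v \<noteq> aug_entry lam T u)} = (\<lambda>j. (j, i)) ` ?J"
    using head_avoids_entry_iff by auto
  then have "phi_col lam T i x = (\<Prod>u\<in>(\<lambda>j. (j, i)) ` ?J. 1 - x ^ card (head lam T u))"
    by (simp add: phi_col_def)
  also have "\<dots> = (\<Prod>j\<in>?J. 1 - x ^ card (head lam T (j, i)))"
    by (subst prod.reindex) (auto simp: inj_on_def)
  also have "\<dots> = (\<Prod>j\<in>?J. gap_weight ?D ?D' x (T j i))"
    by (rule prod.cong) (auto simp: card_head gap_weight_def)
  also have "\<dots> = (\<Prod>u\<in>(\<lambda>j. T j i) ` ?J. gap_weight ?D ?D' x u)"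
    by (subst prod.reindex[OF inj_on_subset[OF column_inj]]) auto
  also have "(\<lambda>j. T j i) ` ?J = ?D - ?D'" by (auto simp: tab_column_def)
  finally show ?thesis by (simp add: gap_prod_def)
qed

end

lemma tab_column_beyond:
  assumes "semistandard_tableau n lam T" "num_columns lam \<le> i"
  shows "tab_column lam T i = {}"
proof -
  have False if "(j, i) \<in> boxes lam" for j
    using boxes_closed[OF assms(1) that, of 0 i] assms(2)
    by (cases lam) (auto simp: boxes_def num_columns_def)
  then show ?thesis by (auto simp: tab_column_def)
qed

theorem theorem35:
  fixes n r :: nat and lam :: "nat list" and mu :: "nat \<Rightarrow> nat" and T :: filling
    and C :: "nat \<Rightarrow> column"
  assumes "1 \<le> n"
    and "semistandard_tableau n lam T"
    and "tab_content lam T = mu"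
    and "num_columns lam = r + 1"
    and "\<And>i. i \<le> r \<Longrightarrow> C i = tab_column lam T i"
  shows "(\<forall>i<r. \<forall>ch. admissible_choice n ch \<longrightarrow>
            contrib2 n ch (C i) (C (i + 1)) =
              t powi (- \<lfloor>col_pairing n (C i)\<rfloor>) *
                (phi_col lam T i t / phi (card (C i) - card (C (i + 1))) t)) \<and>
         contrib1 n (C r) =
           t powi (- \<lfloor>col_pairing n (C r)\<rfloor>) * (phi_col lam T r t / phi (card (C r)) t)"
proof (intro conjI allI impI)
  have sub: "tab_column lam T i \<subseteq> {1..n + 1}" for i by (rule tab_column_subset[OF assms(2)])
  {
    fix i ch assume i: "i < r" and ch: "admissible_choice n ch"
    let ?A = "tab_column lam T i" and ?B = "tab_column lam T (Suc i)"
    have C: "C i = ?A" "C (i + 1) = ?B" using assms(5)[of i] assms(5)[of "i + 1"] i by simp_all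
    have "contrib2 n ch ?A ?B * phi (card ?A - card ?B) t =
        q ^ card (col_inv n ?A) * phi_col lam T i t"
      using contrib2_eq_gap_prod[OF ch sub sub dominates_tab_column[OF assms(2)], of i]
      by (simp add: phi_col_eq_gap_prod[OF assms(2)])
    then show "contrib2 n ch (C i) (C (i + 1)) =
        t powi (- \<lfloor>col_pairing n (C i)\<rfloor>) *
          (phi_col lam T i t / phi (card (C i) - card (C (i + 1))) t)"
      unfolding C t_powi_col_pairing[OF sub] using phi_t_nonzero by (simp add: field_simps)
  }
  let ?D = "tab_column lam T r"
  have C: "C r = ?D" using assms(5) by simp
  \<comment> \<open>Next to the last column stands the empty column, whose gap product is the full
    \<open>phi\<close>; the quotient in the second claim is therefore 1.\<close>
  have "tab_column lam T (Suc r) = {}" using tab_column_beyond[OF assms(2)] assms(4) by simp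
  then have "phi_col lam T r t = phi (card ?D) t"
    using gap_prod_subset[of ?D "{}"] finite_subset[OF sub[of r]]
    by (simp add: phi_col_eq_gap_prod[OF assms(2)])
  then show "contrib1 n (C r) =
      t powi (- \<lfloor>col_pairing n (C r)\<rfloor>) * (phi_col lam T r t / phi (card (C r)) t)"
    unfolding C t_powi_col_pairing[OF sub] contrib1_eq[OF sub] by (simp add: phi_t_nonzero)
qed

end
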